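(* Let $r>0$ be an integer. For all integers $m>n\ge 0$, the number $t_n(m;r)$ of ballot paths to $(n,m)$ avoiding $r$ consecutive $\uparrow$ steps equals $$t_{n}(m;r)=\sum_{i=0}^{m-n-1}\frac{1}{m+1-i}\binom{i-m+n}{i}_{r}\binom{m+1-i}{m-i}_{r}.$$ Furthermore, $t_{n}(n;r)=t_{n-1}(n;r)=\dfrac{1}{n+1}\dbinom{n+1}{n}_{r}$ for all integers $n>0$.
   Context: For integers $n,m\ge 0$ with $m\ge n$, $t_n(m;r)$ is the number of lattice paths from $(0,0)$ to $(n,m)$ with unit steps $\uparrow=(0,1)$ and $\rightarrow=(1,0)$ that stay weakly above the line $y=x$ and contain no $r$ consecutive $\uparrow$ steps. Euler coefficient: for any real $x$ and integer $n\ge 0$, $\binom{x}{n}_r=[t^n](1+t+\cdots+t^{r-1})^x$ (coefficient of $t^n$ in the formal power series), equivalently $\binom{x}{n}_r=\sum_{i=0}^{\lfloor n/r\rfloor}(-1)^i\binom{x}{i}\binom{x+n-ri-1}{n-ri}$, where ordinary binomial coefficients are polynomials in the upper argument (so negative upper arguments are allowed). *)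

theory Defs
  imports
    Complex_Main
    "HOL-Library.Sublist"
    "HOL-Computational_Algebra.Formal_Power_Series"
begin

datatype step = Up | East

definition endpoint :: "step list \<Rightarrow> nat \<times> nat" where
  "endpoint p = (count_list p East, count_list p Up)"

text \<open>A lattice path from the origin is given by its list of steps; the points it visits
  are the endpoints of its prefixes. The constraint \<open>y \<ge> x\<close> on these points is the
  same as on the whole polygonal path, since the steps are axis-parallel unit steps.\<close>

definition weakly_above_diagonal :: "step list \<Rightarrow> bool" where
  "weakly_above_diagonal p \<longleftrightarrow>
     (\<forall>q. prefix q p \<longrightarrow> fst (endpoint q) \<le> snd (endpoint q))"

definition ballot_paths :: "nat \<Rightarrow> nat \<Rightarrow> nat \<Rightarrow> step list set" where
  "ballot_paths r n m =
     {p. endpoint p = (n, m) \<and> weakly_above_diagonal p \<and> \<not> sublist (replicate r Up) p}"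

definition ballot_number :: "nat \<Rightarrow> nat \<Rightarrow> nat \<Rightarrow> nat" where
  "ballot_number r n m = card (ballot_paths r n m)"

lemma length_eq_count_steps: "length p = count_list p East + count_list p Up"
proof (induction p)
  case (Cons a p)
  then show ?case by (cases a) auto
qed simp

lemma finite_ballot_paths: "finite (ballot_paths r n m)"
proof (rule finite_subset)
  show "ballot_paths r n m \<subseteq> {p. set p \<subseteq> {Up, East} \<and> length p = n + m}"
    using step.exhaust by (auto simp: ballot_paths_def endpoint_def length_eq_count_steps)
  show "finite {p. set p \<subseteq> {Up, East} \<and> length p = n + m}"
    by (rule finite_lists_length_eq) simp
qed

text \<open>The power \<open>f\<^sup>x\<close> for \<open>f\<close> with constant term 1: the binomial series
  \<open>(1 + T)\<^sup>x\<close> with \<open>T = f - 1\<close> substituted.\<close>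

definition fps_rpow :: "real fps \<Rightarrow> real \<Rightarrow> real fps" where
  "fps_rpow f x = fps_binomial x oo (f - 1)"

lemma fps_rpow_of_nat:
  assumes "fps_nth f 0 = 1"
  shows "fps_rpow f (real n) = f ^ n"
proof -
  have 0: "fps_nth (f - 1) 0 = 0" using assms by simp
  have "fps_rpow f (real n) = (1 + fps_X) ^ n oo (f - 1)"
    by (simp add: fps_rpow_def fps_binomial_of_nat)
  also have "\<dots> = ((1 + fps_X) oo (f - 1)) ^ n"
    by (rule fps_compose_power[OF 0, symmetric])
  also have "(1 + fps_X) oo (f - 1) = f"
    by (simp add: fps_compose_add_distrib fps_X_fps_compose_startby0[OF 0])
  finally show ?thesis .
qed

definition euler_coeff :: "nat \<Rightarrow> real \<Rightarrow> nat \<Rightarrow> real" where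
  "euler_coeff r x n = fps_nth (fps_rpow (\<Sum>k<r. fps_X ^ k) x) n"

end

theory Submission
  imports Defs
begin

text \<open>
  Cut a path to \<open>(n, m)\<close> at its East steps into \<open>n + 1\<close> runs of Up steps, of lengths
  \<open>a\<^sub>0, \<dots>, a\<^sub>n < r\<close> with sum \<open>m\<close>. The path stays weakly above the diagonal iff the first \<open>k\<close>
  lengths add up to at least \<open>k\<close>, for each \<open>k \<le> n\<close>; if \<open>m > n\<close>, the same condition holds for
  \<open>k = n + 1\<close>. With \<open>f = 1 + X + \<dots> + X\<^bsup>r-1\<^esup>\<close>, the generating function \<open>B\<^sub>N\<close> of such sequences of
  length \<open>N\<close>, marked by their sum, satisfies \<open>B\<^sub>0 = 1\<close> and
  \<open>B\<^bsub>N+1\<^esub> = f B\<^sub>N - c\<^sub>N X\<^sup>N\<close>, where \<open>c\<^sub>N\<close> is the coefficient of \<open>X\<^sup>N\<close> in \<open>f B\<^sub>N\<close>: the only sequences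
  to be discarded are those of sum \<open>N\<close>. Hence \<open>ballot_number r n m\<close> is the coefficient of \<open>X\<^sup>m\<close> in
  \<open>B\<^bsub>n+1\<^esub>\<close> (lemma \<open>ballot_number_eq_nth\<close>).

  Dividing the recursion by powers of \<open>f\<close> and telescoping (lemma \<open>ballot_fps_telescope\<close>) gives
  \<open>f\<^bsup>-k\<^esup> B\<^bsub>N+k\<^esub> = B\<^sub>N - (\<Sum>i<k. c\<^bsub>N+i\<^esub> X\<^bsup>N+i\<^esup> f\<^bsup>-(i+1)\<^esup>)\<close>. The left-hand side has order at least
  \<open>N + k\<close>, which has two consequences. With \<open>N + k = m + 1\<close> the coefficient of \<open>X\<^sup>m\<close> in \<open>B\<^sub>N\<close> is
  read off from the sum. With \<open>N = 0\<close>, after multiplication by \<open>X\<close>, the identity says that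
  \<open>X = (\<Sum>i. c\<^sub>i w\<^bsup>i+1\<^esup>)\<close> up to high order, where \<open>w = X / f\<close>, and Lagrange inversion
  gives \<open>c\<^sub>N = [X\<^sup>N] f\<^bsup>N+1\<^esup> / (N + 1)\<close> (lemma \<open>ballot_return_eq\<close>). These two facts together are
  the formula; for \<open>m = n + 1\<close> only the term \<open>i = 0\<close> is left. Finally, a path to
  \<open>(n, n)\<close> with \<open>n > 0\<close> must end with a single East step from \<open>(n - 1, n)\<close>.
\<close>

section \<open>Power series of ballot sequences\<close>

text \<open>The series \<open>B\<^sub>N\<close>: sequences \<open>a\<^sub>1, \<dots>, a\<^sub>N\<close> of natural numbers with
  \<open>a\<^sub>1 + \<dots> + a\<^sub>k \<ge> k\<close> for all \<open>k \<le> N\<close>, where an entry \<open>a\<close> has the weight \<open>fps_nth f a\<close> and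
  the exponent of \<open>X\<close> is the sum of the sequence.\<close>
fun ballot_fps :: "'a :: field fps \<Rightarrow> nat \<Rightarrow> 'a fps" where
  "ballot_fps f 0 = 1"
| "ballot_fps f (Suc N) =
     f * ballot_fps f N - fps_const (fps_nth (f * ballot_fps f N) N) * fps_X ^ N"

text \<open>The coefficient \<open>c\<^sub>N\<close>: the total weight of the sequences of length \<open>N + 1\<close> that satisfy the
  condition up to \<open>k = N\<close> and violate it at \<open>k = N + 1\<close>, so that their sum is exactly \<open>N\<close>.\<close>
definition ballot_return :: "'a :: field fps \<Rightarrow> nat \<Rightarrow> 'a" where
  "ballot_return f N = fps_nth (f * ballot_fps f N) N"

lemma ballot_fps_nth_eq_0: "i < N \<Longrightarrow> fps_nth (ballot_fps f N) i = 0"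
proof (induction N arbitrary: i)
  case (Suc N)
  have "fps_nth (f * ballot_fps f N) i = 0" if "i < N"
    using that Suc.IH by (auto simp: fps_mult_nth intro!: sum.neutral)
  then show ?case using Suc.prems by (auto simp: fps_X_power_nth less_Suc_eq)
qed simp

lemma ballot_fps_Suc_nth:
  "N < m \<Longrightarrow> fps_nth (ballot_fps f (Suc N)) m = fps_nth (f * ballot_fps f N) m"
  by (simp add: fps_X_power_nth)

lemma ballot_fps_telescope:
  fixes f :: "'a :: field fps"
  assumes "fps_nth f 0 \<noteq> 0"
  shows "inverse f ^ k * ballot_fps f (N + k) =
    ballot_fps f N -
      (\<Sum>i<k. fps_const (ballot_return f (N + i)) * fps_X ^ (N + i) * inverse f ^ Suc i)"
proof (induction k)
  case (Suc k)
  have gf: "inverse f * f = 1" using assms by (rule inverse_mult_eq_1)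
  have "inverse f ^ Suc k * ballot_fps f (N + Suc k) =
      inverse f ^ k * (inverse f * f) * ballot_fps f (N + k)
      - fps_const (ballot_return f (N + k)) * fps_X ^ (N + k) * inverse f ^ Suc k"
    by (simp add: ballot_return_def algebra_simps)
  then show ?case using Suc.IH by (simp add: gf)
qed simp

section \<open>Lagrange inversion\<close>

text \<open>This is the residue computation behind Lagrange inversion, without Laurent series:
  for \<open>w = X / f\<close> the stated coefficient is the residue of \<open>w' / w\<^bsup>p+1\<^esup>\<close>.\<close>
lemma fps_power_mult_deriv_nth:
  fixes f :: "'a :: field_char_0 fps"
  assumes "fps_nth f 0 \<noteq> 0"
  shows "fps_nth (f ^ Suc p * fps_deriv (fps_X * inverse f)) p = (if p = 0 then 1 else 0)"
proof -
  have gf: "f * inverse f = 1" using assms by (rule inverse_mult_eq_1')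
  have "f * fps_deriv (inverse f) = - (fps_deriv f * inverse f)"
  proof -
    have "fps_deriv (f * inverse f) = 0" by (simp add: gf)
    then show ?thesis by (simp add: eq_neg_iff_add_eq_0 algebra_simps)
  qed
  then have eq: "f ^ Suc p * fps_deriv (fps_X * inverse f) =
      f ^ p - fps_X * (f ^ p * inverse f * fps_deriv f)"
  proof -
    have "f ^ Suc p * fps_deriv (fps_X * inverse f) =
        f ^ p * (f * inverse f) + fps_X * (f ^ p * (f * fps_deriv (inverse f)))"
      by (simp add: algebra_simps)
    also have "\<dots> = f ^ p + fps_X * (f ^ p * - (fps_deriv f * inverse f))"
      by (simp only: gf \<open>f * fps_deriv (inverse f) = _\<close> mult_1_right)
    finally show ?thesis by (simp add: algebra_simps)
  qed
  show ?thesis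
  proof (cases p)
    case 0
    with eq show ?thesis by simp
  next
    case (Suc q)
    have "f ^ p * inverse f = f ^ q * (f * inverse f)"
      by (simp add: Suc)
    then have fq: "f ^ p * inverse f = f ^ q" by (simp only: gf mult_1_right)
    have "of_nat p * fps_nth (fps_X * (f ^ p * inverse f * fps_deriv f)) p =
        of_nat p * fps_nth (fps_deriv f * f ^ q) q"
      unfolding fq by (simp add: Suc mult.commute)
    also have "\<dots> = fps_nth (fps_deriv (f ^ p)) q"
      unfolding fps_deriv_power by (simp add: Suc mult.assoc del: of_nat_Suc)
    also have "\<dots> = of_nat p * fps_nth (f ^ p) p"
      unfolding fps_deriv_nth Suc by simp
    finally have "fps_nth (fps_X * (f ^ p * inverse f * fps_deriv f)) p = fps_nth (f ^ p) p"
      by (simp add: Suc del: of_nat_Suc power_Suc)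
    with eq show ?thesis by (simp add: Suc)
  qed
qed

text \<open>With \<open>w = X / f\<close>, the telescoped recursion expresses \<open>X\<close> as the polynomial
  \<open>(\<Sum>i\<le>N. c\<^sub>i w\<^bsup>i+1\<^esup>)\<close> in \<open>w\<close> plus a remainder \<open>R\<close> of order at least \<open>N + 2\<close>. After
  differentiation and multiplication by \<open>f\<^bsup>N+1\<^esup>\<close>, compare the coefficients of \<open>X\<^sup>N\<close>: the remainder
  vanishes, and of the sum only the term \<open>i = N\<close> is left.\<close>
lemma ballot_return_eq:
  fixes f :: "'a :: field_char_0 fps"
  assumes "fps_nth f 0 \<noteq> 0"
  shows "ballot_return f N = fps_nth (f ^ Suc N) N / of_nat (Suc N)"
proof -
  define w where "w = fps_X * inverse f"
  define R where "R = fps_X * (inverse f ^ Suc N * ballot_fps f (Suc N))"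
  have fw: "f * w = fps_X"
    using inverse_mult_eq_1'[OF assms] by (simp add: w_def mult.left_commute)
  have R: "R = fps_X - (\<Sum>i<Suc N. fps_const (ballot_return f i) * w ^ Suc i)"
  proof -
    have "inverse f ^ Suc N * ballot_fps f (Suc N) =
        1 - (\<Sum>i<Suc N. fps_const (ballot_return f i) * fps_X ^ i * inverse f ^ Suc i)"
      using ballot_fps_telescope[OF assms, of "Suc N" 0] by (simp only: add_0 ballot_fps.simps(1))
    moreover have "fps_X * (fps_const c * fps_X ^ i * inverse f ^ Suc i) = fps_const c * w ^ Suc i"
      for c i
      by (simp add: w_def power_mult_distrib mult_ac)
    ultimately show ?thesis
      by (simp only: R_def right_diff_distrib sum_distrib_left mult_1_right)
  qed
  have "fps_nth (inverse f ^ Suc N * ballot_fps f (Suc N)) i = 0" if "i < Suc N" for i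
    using that unfolding fps_mult_nth by (intro sum.neutral)
      (auto simp del: ballot_fps.simps simp: ballot_fps_nth_eq_0)
  then have "fps_nth (fps_deriv R) i = 0" if "i \<le> N" for i
    using that unfolding R_def fps_deriv_nth by (simp del: ballot_fps.simps power_Suc)
  then have "0 = fps_nth (f ^ Suc N * fps_deriv R) N"
    unfolding fps_mult_nth
    by (intro sum.neutral[symmetric]) (auto simp del: fps_deriv_nth)
  also have "fps_deriv R = 1 - (\<Sum>i<Suc N. fps_const (of_nat (Suc i) * ballot_return f i) *
      (w ^ i * fps_deriv w))"
    unfolding R fps_deriv_sub fps_deriv_sum
    by (intro arg_cong2[where f = "(-)"] sum.cong refl)
       (simp_all add: fps_deriv_power' algebra_simps del: power_Suc of_nat_Suc
         flip: fps_of_nat fps_const_mult)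
  also have "fps_nth (f ^ Suc N * \<dots>) N = fps_nth (f ^ Suc N) N -
      (\<Sum>i<Suc N. of_nat (Suc i) * ballot_return f i *
        fps_nth (f ^ Suc N * (w ^ i * fps_deriv w)) N)"
    unfolding right_diff_distrib sum_distrib_left fps_sub_nth fps_sum_nth
      mult.left_commute[of "f ^ Suc N" "fps_const c" for c] fps_mult_left_const_nth
    by (simp only: mult_1_right)
  \<comment> \<open>Since \<open>f * w = X\<close>, the \<open>i\<close>-th term reduces to the residue for \<open>p = N - i\<close>.\<close>
  also have "(\<Sum>i<Suc N. of_nat (Suc i) * ballot_return f i *
        fps_nth (f ^ Suc N * (w ^ i * fps_deriv w)) N) =
      (\<Sum>i<Suc N. if i = N then of_nat (Suc N) * ballot_return f N else 0)"
  proof (intro sum.cong refl)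
    fix i assume "i \<in> {..<Suc N}"
    then have i: "i \<le> N" by simp
    then have "f ^ Suc N = f ^ i * f ^ Suc (N - i)"
      by (simp flip: power_add power_Suc)
    then have "f ^ Suc N * (w ^ i * fps_deriv w) =
        (f * w) ^ i * (f ^ Suc (N - i) * fps_deriv w)"
      by (simp only: power_mult_distrib ac_simps)
    then have "fps_nth (f ^ Suc N * (w ^ i * fps_deriv w)) N =
        fps_nth (f ^ Suc (N - i) * fps_deriv w) (N - i)"
      using i by (simp only: fw fps_X_power_mult_nth) simp
    also have "\<dots> = (if i = N then 1 else 0)"
      using fps_power_mult_deriv_nth[OF assms, of "N - i"] i by (auto simp: w_def)
    finally show "of_nat (Suc i) * ballot_return f i *
        fps_nth (f ^ Suc N * (w ^ i * fps_deriv w)) N =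
      (if i = N then of_nat (Suc N) * ballot_return f N else 0)" by simp
  qed
  finally show ?thesis by (simp add: field_simps del: of_nat_Suc power_Suc)
qed

section \<open>Coefficients in closed form\<close>

lemma ballot_fps_nth_eq_sum:
  fixes f :: "'a :: field_char_0 fps"
  assumes "fps_nth f 0 \<noteq> 0" and "N \<le> m"
  shows "fps_nth (ballot_fps f N) m =
    (\<Sum>i = 0..m - N. fps_nth (f ^ Suc (m - i)) (m - i) / of_nat (Suc (m - i)) *
       fps_nth (inverse f ^ Suc (m - N - i)) i)"
proof -
  \<comment> \<open>The least \<open>k\<close> with \<open>N + k > m\<close>, so that \<open>B\<^bsub>N+k\<^esub>\<close> has no term of degree \<open>m\<close>.\<close>
  define k where "k = Suc (m - N)"
  have Nk: "N + k = Suc m" using assms(2) by (simp add: k_def)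
  have "fps_nth (inverse f ^ k * ballot_fps f (N + k)) m = 0"
    unfolding fps_mult_nth by (intro sum.neutral)
      (auto simp del: ballot_fps.simps simp: Nk ballot_fps_nth_eq_0)
  then have "fps_nth (ballot_fps f N) m = (\<Sum>i<k. ballot_return f (N + i) *
      fps_nth (fps_X ^ (N + i) * inverse f ^ Suc i) m)"
    unfolding ballot_fps_telescope[OF assms(1)]
    by (simp add: fps_sum_nth mult.assoc del: power_Suc)
  also have "\<dots> = (\<Sum>i<k. ballot_return f (N + i) *
      fps_nth (inverse f ^ Suc i) (m - N - i))"
    using assms(2)
    by (intro sum.cong refl) (auto simp: fps_X_power_mult_nth k_def simp del: power_Suc)
  also have "\<dots> = (\<Sum>i = 0..m - N. ballot_return f (m - i) *
      fps_nth (inverse f ^ Suc (m - N - i)) i)"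
    using assms(2)
    by (intro sum.reindex_bij_witness[of _ "\<lambda>i. m - N - i" "\<lambda>i. m - N - i"])
       (auto simp: k_def simp del: power_Suc)
  finally show ?thesis by (simp only: ballot_return_eq[OF assms(1)])
qed

lemma fps_rpow_neg_of_nat:
  assumes "fps_nth f 0 = 1"
  shows "fps_rpow f (- real n) = inverse f ^ n"
proof -
  have 0: "fps_nth (f - 1) 0 = 0" using assms by simp
  have "fps_binomial (- real n) = inverse ((1 + fps_X) ^ n)"
    by (rule fps_binomial_minus_of_nat)
  then have "fps_rpow f (- real n) = inverse ((1 + fps_X) ^ n oo (f - 1))"
    unfolding fps_rpow_def using 0 by (simp add: fps_inverse_compose)
  also have "(1 + fps_X) ^ n oo (f - 1) = f ^ n"
    using fps_rpow_of_nat[OF assms, of n] by (simp add: fps_rpow_def fps_binomial_of_nat)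
  finally show ?thesis by (simp add: fps_inverse_power)
qed

section \<open>Paths and their last run of Up steps\<close>

lemma sublist_replicate_iff: "sublist (replicate r x) (replicate a x) \<longleftrightarrow> r \<le> a"
proof
  assume "sublist (replicate r x) (replicate a x)"
  then show "r \<le> a" by (auto dest: sublist_length_le)
next
  assume "r \<le> a"
  then have "replicate a x = replicate r x @ replicate (a - r) x"
    by (simp flip: replicate_add)
  then show "sublist (replicate r x) (replicate a x)" by simp
qed

lemma sublist_replicate_append_iff:
  assumes "x \<noteq> y"
  shows "sublist (replicate r x) (q @ y # replicate a x) \<longleftrightarrow>
    sublist (replicate r x) q \<or> r \<le> a"
proof -
  have "sublist (replicate r x) q"
    if "replicate r x = xs1 @ xs2" "suffix xs1 q" "prefix xs2 (y # replicate a x)" for xs1 xs2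
  proof -
    have "y \<notin> set (replicate r x)" using assms by simp
    then have "y \<notin> set xs2" unfolding that(1) by simp
    then have "xs2 = []" using that(3) by (cases xs2) auto
    with that show ?thesis by (simp add: suffix_imp_sublist)
  qed
  moreover have "prefix (replicate r x) (y # replicate a x) \<longleftrightarrow> r = 0"
    using assms by (cases r) auto
  ultimately show ?thesis
    unfolding sublist_append sublist_Cons_right sublist_replicate_iff by auto
qed

lemma weakly_above_diagonal_append:
  "weakly_above_diagonal (q @ East # replicate a Up) \<longleftrightarrow>
    weakly_above_diagonal q \<and> count_list q East < count_list q Up"
proof (induction a)
  case 0
  then show ?case
    by (auto simp: weakly_above_diagonal_def endpoint_def)
next
  case (Suc a)
  have "replicate (Suc a) Up = replicate a Up @ [Up]"
    by (simp add: replicate_append_same)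
  then have "q @ East # replicate (Suc a) Up = (q @ East # replicate a Up) @ [Up]" by simp
  moreover have "weakly_above_diagonal (p @ [Up]) \<longleftrightarrow> weakly_above_diagonal p" for p
    by (fastforce simp: weakly_above_diagonal_def endpoint_def)
  ultimately show ?case using Suc.IH by metis
qed

lemma count_list_replicate: "count_list (replicate n x) y = (if x = y then n else 0)"
  by (induction n) auto

lemma East_notin_set: "East \<notin> set p \<Longrightarrow> p = replicate (length p) Up"
  by (rule replicate_length_same[symmetric]) (metis step.exhaust)

lemma ballot_number_0: "ballot_number r 0 m = (if m < r then 1 else 0)"
proof -
  have above: "weakly_above_diagonal (replicate m Up)"
    unfolding weakly_above_diagonal_def endpoint_def
  proof (intro allI impI)
    fix q assume "prefix q (replicate m Up)"
    then have "set q \<subseteq> {Up}" by (auto dest!: set_mono_prefix split: if_splits)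
    then have "East \<notin> set q" by auto
    then show "fst (count_list q East, count_list q Up) \<le> snd (count_list q East, count_list q Up)"
      by simp
  qed
  have only: "p = replicate m Up" if "endpoint p = (0, m)" for p
    using that East_notin_set[of p] length_eq_count_steps[of p]
    by (auto simp: endpoint_def count_list_0_iff)
  have "endpoint (replicate m Up) = (0, m)"
    by (simp add: endpoint_def count_list_replicate)
  then have "replicate m Up \<in> ballot_paths r 0 m \<longleftrightarrow> m < r"
    using above by (simp add: ballot_paths_def sublist_replicate_iff not_le)
  moreover have "ballot_paths r 0 m \<subseteq> {replicate m Up}"
    using only by (auto simp only: ballot_paths_def)
  ultimately have "ballot_paths r 0 m = (if m < r then {replicate m Up} else {})"
    by auto
  then show ?thesis by (simp add: ballot_number_def)
qed

text \<open>A path with an East step splits uniquely into a path before the last East step and the final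
  run of \<open>a\<close> Up steps. The condition \<open>a + n < m\<close> says that the point \<open>(n + 1, m - a)\<close> after that
  East step is still weakly above the diagonal.\<close>
lemma ballot_paths_Suc:
  "ballot_paths r (Suc n) m =
    (\<Union>a\<in>{a. a < r \<and> a + n < m}. (\<lambda>q. q @ East # replicate a Up) ` ballot_paths r n (m - a))"
proof -
  have snoc: "q @ East # replicate a Up \<in> ballot_paths r (Suc n) m \<longleftrightarrow>
      a < r \<and> a + n < m \<and> q \<in> ballot_paths r n (m - a)" for q a
    using sublist_replicate_append_iff[of Up East r q a]
    by (auto simp: ballot_paths_def endpoint_def weakly_above_diagonal_append
        count_list_replicate)
  have split: "\<exists>q a. p = q @ East # replicate a Up" if "p \<in> ballot_paths r (Suc n) m" for p
  proof -
    have "East \<in> set p"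
      using that count_notin[of East p] by (auto simp: ballot_paths_def endpoint_def)
    then obtain q z where "p = q @ East # z" "East \<notin> set z"
      by (metis split_list_last)
    with East_notin_set[of z] show ?thesis by metis
  qed
  show ?thesis
  proof (intro equalityI subsetI)
    fix p assume p: "p \<in> ballot_paths r (Suc n) m"
    with split obtain q a where "p = q @ East # replicate a Up" by blast
    with p show "p \<in> (\<Union>a\<in>{a. a < r \<and> a + n < m}.
        (\<lambda>q. q @ East # replicate a Up) ` ballot_paths r n (m - a))"
      by (auto simp: snoc)
  qed (auto simp: snoc)
qed

lemma ballot_number_Suc:
  "ballot_number r (Suc n) m = (\<Sum>a | a < r \<and> a + n < m. ballot_number r n (m - a))"
proof -
  have disj: "a = b" if "q @ East # replicate a Up = q' @ East # replicate b Up" for q q' a b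
  proof -
    have "takeWhile (\<lambda>s. s = Up) (rev (p @ East # replicate c Up)) = replicate c Up" for p c
      by (simp, subst takeWhile_append2) auto
    from this[of q a] this[of q' b] that have "replicate a Up = replicate b Up" by simp
    then show ?thesis by (metis length_replicate)
  qed
  have inj: "inj_on (\<lambda>q. q @ East # replicate a Up) S" for a S
    by (auto intro: inj_onI)
  have "ballot_number r (Suc n) m = (\<Sum>a | a < r \<and> a + n < m.
      card ((\<lambda>q. q @ East # replicate a Up) ` ballot_paths r n (m - a)))"
    unfolding ballot_number_def ballot_paths_Suc
    by (intro card_UN_disjoint) (auto simp: finite_ballot_paths dest: disj)
  then show ?thesis by (simp add: card_image[OF inj] ballot_number_def)
qed

text \<open>For \<open>m > n\<close> the counts obey the recursion of the series \<open>B\<^bsub>n+1\<^esub>\<close>; at \<open>m = n\<close> they can differ, since the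
  series also imposes the condition on the sum of all \<open>n + 1\<close> runs.\<close>
lemma ballot_number_eq_nth:
  assumes "n < m"
  shows "real (ballot_number r n m) = fps_nth (ballot_fps (\<Sum>k<r. fps_X ^ k) (Suc n)) m"
  using assms
proof (induction n arbitrary: m)
  case 0
  then show ?case
    by (simp add: ballot_number_0 fps_sum_nth fps_X_power_nth)
next
  case (Suc n)
  have "fps_nth (ballot_fps (\<Sum>k<r. fps_X ^ k) (Suc (Suc n))) m =
      fps_nth ((\<Sum>k<r. fps_X ^ k) * ballot_fps (\<Sum>k<r. fps_X ^ k) (Suc n)) m"
    using Suc.prems by (rule ballot_fps_Suc_nth)
  also have "\<dots> = (\<Sum>a<r. if m < a then 0 else
      fps_nth (ballot_fps (\<Sum>k<r. fps_X ^ k) (Suc n)) (m - a))"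
    by (simp only: sum_distrib_right fps_sum_nth fps_X_power_mult_nth)
  also have "\<dots> = (\<Sum>a | a < r \<and> a + n < m.
      fps_nth (ballot_fps (\<Sum>k<r. fps_X ^ k) (Suc n)) (m - a))"
    by (rule sum.mono_neutral_cong_right) 
      (auto simp del: ballot_fps.simps intro!: ballot_fps_nth_eq_0)
  also have "\<dots> = (\<Sum>a | a < r \<and> a + n < m. real (ballot_number r n (m - a)))"
    by (intro sum.cong refl Suc.IH[symmetric]) auto
  finally show ?case by (simp add: ballot_number_Suc)
qed

text \<open>On the diagonal, only the empty final run is possible.\<close>
lemma ballot_number_diagonal:
  assumes "r > 0"
  shows "ballot_number r (Suc n) (Suc n) = ballot_number r n (Suc n)"
proof -
  have "{a. a < r \<and> a + n < Suc n} = {0}" using assms by auto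
  then show ?thesis by (simp add: ballot_number_Suc)
qed

section \<open>The formula for ballot paths\<close>

theorem corollary9:
  fixes r :: nat
  assumes "r > 0"
  shows "(\<forall>m n :: nat. n < m \<longrightarrow>
            real (ballot_number r n m) =
              (\<Sum>i = 0..m - n - 1.
                 1 / (real m + 1 - real i)
                   * euler_coeff r (real i - real m + real n) i
                   * euler_coeff r (real m + 1 - real i) (m - i)))
       \<and> (\<forall>n :: nat. n > 0 \<longrightarrow>
            real (ballot_number r n n) = real (ballot_number r (n - 1) n) \<and>
            real (ballot_number r (n - 1) n) = 1 / (real n + 1) * euler_coeff r (real n + 1) n)"
proof -
  define f :: "real fps" where "f = (\<Sum>k<r. fps_X ^ k)"
  have f0: "fps_nth f 0 = 1"
    using assms by (simp add: f_def fps_sum_nth fps_X_power_nth)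
  have pos: "euler_coeff r x n = fps_nth (f ^ k) n" if "x = real k" for x k n
    using fps_rpow_of_nat[OF f0] that by (simp add: euler_coeff_def f_def)
  have neg: "euler_coeff r x n = fps_nth (inverse f ^ k) n" if "x = - real k" for x k n
    using fps_rpow_neg_of_nat[OF f0] that by (simp add: euler_coeff_def f_def)
  have formula: "real (ballot_number r n m) =
      (\<Sum>i = 0..m - n - 1.
         1 / (real m + 1 - real i)
           * euler_coeff r (real i - real m + real n) i
           * euler_coeff r (real m + 1 - real i) (m - i))" if "n < m" for m n
  proof -
    have "real (ballot_number r n m) = fps_nth (ballot_fps f (Suc n)) m"
      unfolding f_def by (rule ballot_number_eq_nth[OF that])
    also have "\<dots> = (\<Sum>i = 0..m - Suc n. fps_nth (f ^ Suc (m - i)) (m - i) / of_nat (Suc (m - i)) *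
       fps_nth (inverse f ^ Suc (m - Suc n - i)) i)"
      using that f0 by (intro ballot_fps_nth_eq_sum) auto
    also have "\<dots> = (\<Sum>i = 0..m - n - 1.
         1 / (real m + 1 - real i)
           * euler_coeff r (real i - real m + real n) i
           * euler_coeff r (real m + 1 - real i) (m - i))"
    proof (intro sum.cong)
      fix i assume "i \<in> {0..m - n - 1}"
      then have i: "i \<le> m - n - 1" by simp
      have "real m + 1 - real i = real (Suc (m - i))"
        and "real i - real m + real n = - real (Suc (m - Suc n - i))"
        using i that by (auto simp: of_nat_diff)
      then show "fps_nth (f ^ Suc (m - i)) (m - i) / of_nat (Suc (m - i)) *
          fps_nth (inverse f ^ Suc (m - Suc n - i)) i =
        1 / (real m + 1 - real i)
           * euler_coeff r (real i - real m + real n) i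
           * euler_coeff r (real m + 1 - real i) (m - i)"
        by (simp only: pos[OF refl] neg[OF refl]) simp
    qed simp
    finally show ?thesis .
  qed
  have "real (ballot_number r (n - 1) n) = 1 / (real n + 1) * euler_coeff r (real n + 1) n"
    if "n > 0" for n
  proof -
    have "euler_coeff r (real 0 - real n + real (n - 1)) 0 = 1"
      using that f0 by (subst neg[of _ 1]) (auto simp: of_nat_diff)
    with formula[of "n - 1" n] that show ?thesis by simp
  qed
  moreover have "real (ballot_number r n n) = real (ballot_number r (n - 1) n)" if "n > 0" for n
    using ballot_number_diagonal[OF assms, of "n - 1"] that by simp
  ultimately show ?thesis using formula by blast
qed

end
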